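(* Let $K,N\ge1$ be integers, $\sigma^2>0$, $\rho_k\in\mathbb{R}$ and $h_k,g_{k,n},f_n\in\mathbb{C}$ for $1\le k\le K$, $1\le n\le N$. Given $a_{k,1},a_{k,2}\in\mathbb{C}$ ($1\le k\le K$), $b_n\in\mathbb{C}$ ($1\le n\le N$) and $c_1\in\mathbb{C}$, the optimal $c_2^*\in\mathbb{C}$ that minimizes, over $c_2\in\mathbb{C}$, $$\sum_{k=1}^K\left|c_1h_ka_{k,1}+c_2\left(h_ka_{k,2}+a_{k,1}\sum_{n=1}^Nf_nb_ng_{k,n}\right)-\rho_k\right|^2+|c_2|^2\left(1+\sum_{n=1}^N|f_n|^2|b_n|^2\right)\sigma^2$$ is given by $$c_2^*=\frac{\sum_{k=1}^K(\rho_k-c_1h_ka_{k,1})\,\overline{\left(h_ka_{k,2}+a_{k,1}\sum_{n=1}^Nf_nb_ng_{k,n}\right)}}{\sum_{k=1}^K\left|h_ka_{k,2}+a_{k,1}\sum_{n=1}^Nf_nb_ng_{k,n}\right|^2+\left(1+\sum_{n=1}^N|f_n|^2|b_n|^2\right)\sigma^2}.$$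
   Context: Overline denotes complex conjugation. Interpretation: $c_2$ is the receive scalar of an access point in the second phase of a two-phase relay-assisted aggregation scheme with $K$ devices and $N$ relays; the objective is the part of the mean-square aggregation error depending on $c_2$. *)

theory Defs
  imports "HOL-Analysis.Analysis"
begin

text \<open>Devices are indexed by \<open>k \<in> {1..K}\<close>, relays by \<open>n \<in> {1..N}\<close>, and \<open>a k i\<close> is the transmit
  scalar of device \<open>k\<close> in phase \<open>i \<in> {1, 2}\<close>. All families are total functions; only their values
  at these indices enter the definitions below.\<close>

text \<open>Coefficient with which the symbol of device \<open>k\<close> enters the signal received in phase two:
  its direct transmission plus its first-phase transmission forwarded by the relays.\<close>

definition phase2_coeff ::
  "nat \<Rightarrow> (nat \<Rightarrow> complex) \<Rightarrow> (nat \<Rightarrow> nat \<Rightarrow> complex) \<Rightarrow> (nat \<Rightarrow> complex) \<Rightarrow>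
   (nat \<Rightarrow> nat \<Rightarrow> complex) \<Rightarrow> (nat \<Rightarrow> complex) \<Rightarrow> nat \<Rightarrow> complex" where
  "phase2_coeff N h g f a b k = h k * a k 2 + a k 1 * (\<Sum>n=1..N. f n * b n * g k n)"

definition phase2_noise_power ::
  "nat \<Rightarrow> real \<Rightarrow> (nat \<Rightarrow> complex) \<Rightarrow> (nat \<Rightarrow> complex) \<Rightarrow> real" where
  "phase2_noise_power N \<sigma> f b = (1 + (\<Sum>n=1..N. (cmod (f n))\<^sup>2 * (cmod (b n))\<^sup>2)) * \<sigma>\<^sup>2"

text \<open>The part of the mean-square aggregation error that depends on the receive scalar \<open>c2\<close>.\<close>

definition aggregation_error ::
  "nat \<Rightarrow> nat \<Rightarrow> real \<Rightarrow> (nat \<Rightarrow> real) \<Rightarrow> (nat \<Rightarrow> complex) \<Rightarrow> (nat \<Rightarrow> nat \<Rightarrow> complex) \<Rightarrow>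
   (nat \<Rightarrow> complex) \<Rightarrow> (nat \<Rightarrow> nat \<Rightarrow> complex) \<Rightarrow> (nat \<Rightarrow> complex) \<Rightarrow> complex \<Rightarrow> complex \<Rightarrow> real" where
  "aggregation_error K N \<sigma> \<rho> h g f a b c1 c2 =
     (\<Sum>k=1..K. (cmod (c1 * h k * a k 1 + c2 * phase2_coeff N h g f a b k
                       - complex_of_real (\<rho> k)))\<^sup>2)
     + (cmod c2)\<^sup>2 * phase2_noise_power N \<sigma> f b"

end

theory Submission
  imports Defs
begin

text \<open>Completing the square: with \<open>D\<close> the denominator and \<open>P\<close> the numerator of the claimed
  minimizer, the objective equals \<open>D * \<bar>c2 - P / D\<bar>\<^sup>2\<close> plus a term independent of \<open>c2\<close>.
  As \<open>D > 0\<close>, it is minimal exactly at \<open>c2 = P / D\<close>.\<close>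

text \<open>Since \<open>x \<bullet> y\<close> is the real part of \<open>x * cnj y\<close>, the
  factor \<open>d\<close> moves across the inner product as \<open>cnj d\<close>. The cross term is
  then linear in \<open>r * cnj d\<close>, so summing over the index set collects it into
  \<open>c \<bullet> P\<close>.\<close>

lemma cmod_mult_diff_squared:
  "(cmod (c * d - r))\<^sup>2 = (cmod c)\<^sup>2 * (cmod d)\<^sup>2 - 2 * (c \<bullet> (r * cnj d)) + (cmod r)\<^sup>2"
  unfolding cmod_power2 by (simp add: inner_complex_def power2_eq_square algebra_simps)

lemma regularized_least_squares_complete_square:
  fixes A :: "'i set" and d r :: "'i \<Rightarrow> complex" and w :: real
  defines "D \<equiv> (\<Sum>i\<in>A. (cmod (d i))\<^sup>2) + w" and "P \<equiv> \<Sum>i\<in>A. r i * cnj (d i)"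
  assumes "D \<noteq> 0"
  shows "(\<Sum>i\<in>A. (cmod (c * d i - r i))\<^sup>2) + (cmod c)\<^sup>2 * w =
    D * (cmod (c - P / complex_of_real D))\<^sup>2 + ((\<Sum>i\<in>A. (cmod (r i))\<^sup>2) - (cmod P)\<^sup>2 / D)"
proof -
  have "(\<Sum>i\<in>A. (cmod (c * d i - r i))\<^sup>2) + (cmod c)\<^sup>2 * w =
      D * (cmod c)\<^sup>2 - 2 * (c \<bullet> P) + (\<Sum>i\<in>A. (cmod (r i))\<^sup>2)"
    by (simp add: cmod_mult_diff_squared D_def P_def sum.distrib sum_subtractf
        inner_sum_right sum_distrib_left algebra_simps)
  moreover have "D * (cmod (c - P / complex_of_real D))\<^sup>2 =
      D * (cmod c)\<^sup>2 - 2 * (c \<bullet> P) + (cmod P)\<^sup>2 / D"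
  proof -
    \<comment> \<open>Replacing \<open>P\<close> by \<open>D * m\<close> for an opaque
      \<open>m\<close> clears the division: what remains is a polynomial identity in
      \<open>D\<close> and the real and imaginary parts of \<open>c\<close> and
      \<open>m\<close>.\<close>
    have "P = complex_of_real D * (P / complex_of_real D)"
      using \<open>D \<noteq> 0\<close> by simp
    then obtain m where m: "P / complex_of_real D = m" "P = complex_of_real D * m"
      by blast
    have "(cmod P)\<^sup>2 / D = D * (cmod m)\<^sup>2"
      using \<open>D \<noteq> 0\<close> by (simp add: m(2) norm_mult power_mult_distrib) (simp add: power2_eq_square)
    then show ?thesis
      unfolding m(1) \<open>(cmod P)\<^sup>2 / D = D * (cmod m)\<^sup>2\<close> cmod_power2
      by (simp add: m(2) inner_complex_def power2_eq_square algebra_simps)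
  qed
  ultimately show ?thesis by simp
qed

lemma is_arg_min_strict_minimum_iff:
  fixes F :: "'a \<Rightarrow> 'b::linorder"
  assumes "\<And>x. x \<noteq> m \<Longrightarrow> F m < F x"
  shows "is_arg_min F (\<lambda>_. True) c \<longleftrightarrow> c = m"
  unfolding is_arg_min_def using assms by (metis less_asym less_irrefl)

text \<open>The weight \<open>w > 0\<close> keeps the denominator positive even if every
  \<open>d i\<close> vanishes, so the minimizer is always unique.\<close>

lemma is_arg_min_regularized_least_squares_iff:
  fixes d r :: "'i \<Rightarrow> complex" and w :: real
  assumes "w > 0"
  shows "is_arg_min (\<lambda>c. (\<Sum>i\<in>A. (cmod (c * d i - r i))\<^sup>2) + (cmod c)\<^sup>2 * w) (\<lambda>_. True) c \<longleftrightarrow>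
    c = (\<Sum>i\<in>A. r i * cnj (d i)) / complex_of_real ((\<Sum>i\<in>A. (cmod (d i))\<^sup>2) + w)"
    (is "is_arg_min ?E _ c \<longleftrightarrow> c = ?m")
proof -
  let ?D = "(\<Sum>i\<in>A. (cmod (d i))\<^sup>2) + w"
  have D: "?D > 0"
    using assms by (simp add: add_nonneg_pos sum_nonneg)
  note E = regularized_least_squares_complete_square[OF D[THEN less_imp_neq, symmetric]]
  have less: "?E ?m < ?E x" if "x \<noteq> ?m" for x
    \<comment> \<open>Both values share the same constant term; the square vanishes at the candidate
      and is positive at \<open>x\<close>.\<close>
    unfolding E using D that by simp
  show ?thesis
    using less by (rule is_arg_min_strict_minimum_iff)
qed

lemma phase2_noise_power_pos:
  assumes "\<sigma>\<^sup>2 > 0"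
  shows "phase2_noise_power N \<sigma> f b > 0"
  unfolding phase2_noise_power_def
  using assms by (intro mult_pos_pos add_pos_nonneg sum_nonneg) auto

theorem proposition3p3:
  fixes K N :: nat
    and \<sigma> :: real
    and \<rho> :: "nat \<Rightarrow> real"
    and h f b :: "nat \<Rightarrow> complex"
    and g a :: "nat \<Rightarrow> nat \<Rightarrow> complex"
    and c1 :: complex
  assumes "K \<ge> 1" and "N \<ge> 1" and "\<sigma>\<^sup>2 > 0"
  shows "\<forall>c2. is_arg_min (aggregation_error K N \<sigma> \<rho> h g f a b c1) (\<lambda>_. True) c2 \<longleftrightarrow>
    c2 = (\<Sum>k=1..K. (complex_of_real (\<rho> k) - c1 * h k * a k 1)
                       * cnj (phase2_coeff N h g f a b k))
         / complex_of_real ((\<Sum>k=1..K. (cmod (phase2_coeff N h g f a b k))\<^sup>2)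
                             + phase2_noise_power N \<sigma> f b)"
proof -
  \<comment> \<open>The first-phase contribution does not involve \<open>c2\<close>, so it is moved
    into the target, leaving a regularized least-squares problem in \<open>c2\<close> with the noise
    power as weight.\<close>
  have "aggregation_error K N \<sigma> \<rho> h g f a b c1 =
      (\<lambda>c. (\<Sum>k=1..K. (cmod (c * phase2_coeff N h g f a b k
                          - (complex_of_real (\<rho> k) - c1 * h k * a k 1)))\<^sup>2)
        + (cmod c)\<^sup>2 * phase2_noise_power N \<sigma> f b)"
    by (simp add: fun_eq_iff aggregation_error_def algebra_simps)
  then show ?thesis
    by (simp only: is_arg_min_regularized_least_squares_iff[OF phase2_noise_power_pos[OF assms(3)]]
        simp_thms)
qed

end
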